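(* Let $X$, $Y$ be Hausdorff topological spaces, and assume that $X$ is locally compact. Then for any continuous surjective open map $f\colon X\to Y$, the map $\mathcal{K}(f)\colon\mathcal{K}(X)\to\mathcal{K}(Y)$, $A\mapsto f(A)$, is also surjective and open.
   Context: For a Hausdorff topological space $X$, $\mathcal{K}(X)$ denotes the set of non-empty compact subsets of $X$ with the Vietoris topology, generated by the basis elements $\mathcal{V}(U_0,\dots,U_n)=\{K\in\mathcal{K}(X): K\subseteq U_0,\ K\cap U_i\neq\emptyset \text{ for } 1\le i\le n\}$ with $n\in\mathbb{N}$ and $U_0,\dots,U_n$ open in $X$. *)

theory Defs
  imports "HOL-Analysis.Analysis"
begin

definition compacts_of :: "'a topology \<Rightarrow> 'a set set" where
  "compacts_of X = {K. compactin X K \<and> K \<noteq> {}}"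

definition vietoris_basic :: "'a topology \<Rightarrow> nat \<Rightarrow> (nat \<Rightarrow> 'a set) \<Rightarrow> 'a set set" where
  "vietoris_basic X n U =
     {K \<in> compacts_of X. K \<subseteq> U 0 \<and> (\<forall>i\<in>{1..n}. K \<inter> U i \<noteq> {})}"

(* Only U 0, ..., U n matter in vietoris_basic X n U, so openness is required of these only.
   Taking n = 0 and U 0 = topspace X shows that the carrier is all of compacts_of X, and the
   generating family is closed under binary intersections, so that it is a base. Both facts
   are proved below. *)
definition vietoris :: "'a topology \<Rightarrow> 'a set topology" where
  "vietoris X =
     topology_generated_by {vietoris_basic X n U | n U. \<forall>i\<le>n. openin X (U i)}"

lemma topspace_vietoris: "topspace (vietoris X) = compacts_of X"
proof -
  have "compacts_of X = vietoris_basic X 0 (\<lambda>_. topspace X)"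
    by (auto simp: vietoris_basic_def compacts_of_def dest: compactin_subset_topspace)
  then have "compacts_of X \<in> {vietoris_basic X n U | n U. \<forall>i\<le>n. openin X (U i)}"
    by blast
  then show ?thesis
    unfolding vietoris_def topology_generated_by_topspace
    by (auto simp: vietoris_basic_def)
qed

lemma vietoris_basic_Int:
  "vietoris_basic X m U \<inter> vietoris_basic X n V =
     vietoris_basic X (m + n) (\<lambda>i. if i = 0 then U 0 \<inter> V 0 else if i \<le> m then U i else V (i - m))"
  (is "?L = vietoris_basic X (m + n) ?W")
proof -
  have "(\<forall>i\<in>{1..m + n}. K \<inter> ?W i \<noteq> {}) \<longleftrightarrow>
        (\<forall>i\<in>{1..m}. K \<inter> U i \<noteq> {}) \<and> (\<forall>i\<in>{1..n}. K \<inter> V i \<noteq> {})" (is "?A \<longleftrightarrow> ?B \<and> ?C") for K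
  proof (intro iffI conjI ballI)
    fix i assume A: "?A" and i: "i \<in> {1..m}"
    from i have "i \<in> {1..m + n}" by simp
    from bspec[OF A this] i show "K \<inter> U i \<noteq> {}" by simp
  next
    fix i assume A: "?A" and i: "i \<in> {1..n}"
    from i have "m + i \<in> {1..m + n}" by simp
    from bspec[OF A this] i show "K \<inter> V i \<noteq> {}" by simp
  next
    fix i assume BC: "?B \<and> ?C" and i: "i \<in> {1..m + n}"
    show "K \<inter> ?W i \<noteq> {}"
    proof (cases "i \<le> m")
      case True
      then have "i \<in> {1..m}" using i by simp
      with BC have "K \<inter> U i \<noteq> {}" by blast
      then show ?thesis using True i by simp
    next
      case False
      then have "i - m \<in> {1..n}" using i by auto
      with BC have "K \<inter> V (i - m) \<noteq> {}" by blast
      then show ?thesis using False by simp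
    qed
  qed
  then have "K \<in> ?L \<longleftrightarrow> K \<in> vietoris_basic X (m + n) ?W" for K
    unfolding vietoris_basic_def Int_iff mem_Collect_eq by simp blast
  then show ?thesis by (rule set_eqI)
qed

end

theory Submission
  imports Defs
begin

text \<open>
  Everything rests on lifting compact sets. If \<open>L\<close> is compact and contained in
  \<open>f ` U\<close> with \<open>U\<close> open, then local compactness of the Hausdorff space
  \<open>X\<close> covers \<open>U\<close> by interiors of compact subsets of \<open>U\<close>;
  their images under \<open>f\<close> are open because \<open>f\<close> is, so finitely many of them
  cover \<open>L\<close>. The part lying over \<open>L\<close> of the corresponding finite union of
  compact sets is a compact subset of \<open>U\<close> whose image is exactly \<open>L\<close>
  (\<open>compact_lift\<close>). For \<open>U = topspace X\<close> this is surjectivity.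

  For openness, a lift of \<open>L\<close> inside \<open>U 0\<close> may be enlarged by finitely many points of \<open>U 0\<close> lying
  over \<open>L\<close>, chosen so that it also meets the other \<open>U i\<close>. Hence \<open>\<K>(f)\<close> carries a basic
  Vietoris set onto a basic Vietoris set (\<open>image_vietoris_basic\<close>). Since the basic sets form a
  base and not just a subbase, and images commute with unions, this suffices.
\<close>

text \<open>Basic sets are closed under binary intersection, so the subbase that generates the Vietoris
  topology is a base. This is needed because direct images do not commute with intersections.\<close>

lemma openin_vietoris_imp_basic_nbhd:
  assumes "openin (vietoris X) W" and "K \<in> W"
  obtains n U where "\<forall>i\<le>n. openin X (U i)" "K \<in> vietoris_basic X n U" "vietoris_basic X n U \<subseteq> W"
proof -
  let ?B = "{vietoris_basic X n U | n U. \<forall>i\<le>n. openin X (U i)}"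
  have "generate_topology_on ?B W"
    using assms(1) by (simp add: vietoris_def openin_topology_generated_by_iff)
  then have "\<forall>K\<in>W. \<exists>B\<in>?B. K \<in> B \<and> B \<subseteq> W"
  proof (induction rule: generate_topology_on.induct)
    case Empty
    show ?case by simp
  next
    case (Int a b)
    show ?case
    proof
      fix K assume "K \<in> a \<inter> b"
      then obtain A B where A: "A \<in> ?B" "K \<in> A" "A \<subseteq> a" and B: "B \<in> ?B" "K \<in> B" "B \<subseteq> b"
        using bspec[OF Int.IH(1), of K] bspec[OF Int.IH(2), of K] by (elim IntE bexE) blast
      obtain m U where U: "A = vietoris_basic X m U" "\<forall>i\<le>m. openin X (U i)"
        using A(1) by blast
      obtain n V where V: "B = vietoris_basic X n V" "\<forall>i\<le>n. openin X (V i)"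
        using B(1) by blast
      let ?W = "\<lambda>i. if i = 0 then U 0 \<inter> V 0 else if i \<le> m then U i else V (i - m)"
      have "\<forall>i\<le>m + n. openin X (?W i)"
        using U(2) V(2) by auto
      moreover have "A \<inter> B = vietoris_basic X (m + n) ?W"
        unfolding U(1) V(1) by (rule vietoris_basic_Int)
      ultimately have "A \<inter> B \<in> ?B"
        by blast
      then show "\<exists>B\<in>?B. K \<in> B \<and> B \<subseteq> a \<inter> b"
        using A B by (intro bexI[of _ "A \<inter> B"]) auto
    qed
  next
    case (UN k)
    show ?case
    proof
      fix K assume "K \<in> \<Union>k"
      then obtain a where a: "a \<in> k" "K \<in> a"
        by blast
      then obtain B where "B \<in> ?B" "K \<in> B" "B \<subseteq> a"
        using UN.IH[OF a(1)] by meson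
      with a(1) show "\<exists>B\<in>?B. K \<in> B \<and> B \<subseteq> \<Union>k"
        by (intro bexI[of _ B]) auto
    qed
  next
    case (Basis s)
    then show ?case by blast
  qed
  with assms(2) that show thesis by blast
qed

lemma openin_vietoris_basic:
  assumes "\<forall>i\<le>n. openin X (U i)"
  shows "openin (vietoris X) (vietoris_basic X n U)"
  unfolding vietoris_def
  by (rule topology_generated_by_Basis) (use assms in blast)

text \<open>The finite subcover argument yields a compact \<open>C \<subseteq> U\<close> whose image merely covers \<open>L\<close>.
  The other points of \<open>C\<close> can be discarded without losing compactness because \<open>L\<close> is closed in
  the Hausdorff space \<open>Y\<close>.\<close>

lemma compact_lift:
  assumes "Hausdorff_space X" "Hausdorff_space Y" "locally_compact_space X"
    and cont: "continuous_map X Y f" and op: "open_map X Y f"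
    and U: "openin X U" and L: "compactin Y L" "L \<subseteq> f ` U"
  obtains K where "compactin X K" "K \<subseteq> U" "f ` K = L"
proof -
  have "neighbourhood_base_of (compactin X) X"
    using assms(1,3) locally_compact_space_neighbourhood_base by blast
  then have "\<forall>x\<in>U. \<exists>V C. openin X V \<and> compactin X C \<and> x \<in> V \<and> V \<subseteq> C \<and> C \<subseteq> U"
    using U unfolding neighbourhood_base_of by blast
  then obtain V C where VC: "\<And>x. x \<in> U \<Longrightarrow> openin X (V x) \<and> compactin X (C x) \<and> x \<in> V x
      \<and> V x \<subseteq> C x \<and> C x \<subseteq> U"
    by metis
  have "\<exists>\<F>. finite \<F> \<and> \<F> \<subseteq> (\<lambda>x. f ` V x) ` U \<and> L \<subseteq> \<Union>\<F>"
  proof (rule compactinD[OF L(1)])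
    show "openin Y T" if "T \<in> (\<lambda>x. f ` V x) ` U" for T
      using that VC op by (auto simp: open_map_def)
    show "L \<subseteq> \<Union>((\<lambda>x. f ` V x) ` U)"
      using L(2) VC by blast
  qed
  then obtain \<F> where \<F>: "finite \<F>" "\<F> \<subseteq> (\<lambda>x. f ` V x) ` U" "L \<subseteq> \<Union>\<F>"
    by blast
  obtain F where F: "F \<subseteq> U" "finite F" "\<F> = (\<lambda>x. f ` V x) ` F"
    using finite_subset_image[OF \<F>(1,2)] by blast
  then have F: "finite F" "F \<subseteq> U" "L \<subseteq> (\<Union>x\<in>F. f ` V x)"
    using \<F>(3) by auto
  define D where "D = (\<Union>x\<in>F. C x)"
  have D: "compactin X D"
    unfolding D_def using F VC by (intro compactin_Union) auto
  have "closedin X {x \<in> topspace X. f x \<in> L}"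
    using cont compactin_imp_closedin[OF assms(2) L(1)] closedin_continuous_map_preimage by blast
  then have "compactin X ({x \<in> topspace X. f x \<in> L} \<inter> D)"
    using D closed_Int_compactin by blast
  moreover have "{x \<in> topspace X. f x \<in> L} \<inter> D \<subseteq> U"
    unfolding D_def using F VC by blast
  moreover have "f ` ({x \<in> topspace X. f x \<in> L} \<inter> D) = L"
  proof -
    have "y \<in> f ` ({x \<in> topspace X. f x \<in> L} \<inter> D)" if "y \<in> L" for y
    proof -
      obtain x v where "x \<in> F" "v \<in> V x" "y = f v"
        using F(3) \<open>y \<in> L\<close> by auto
      then have "v \<in> D" "y = f v"
        unfolding D_def using F(2) VC by blast+
      then show ?thesis
        using that compactin_subset_topspace[OF D] by blast
    qed
    then show ?thesis by blast
  qed
  ultimately show thesis by (rule that)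
qed

text \<open>On the right, \<open>U i\<close> must be cut down to \<open>U 0\<close> before taking images: a point witnessing that
  \<open>L\<close> meets \<open>f ` U i\<close> could otherwise have all its preimages in \<open>U i\<close> outside \<open>U 0\<close>. Since
  \<open>U 0 \<inter> U 0 = U 0\<close>, the same formula also serves for the index 0.\<close>

lemma image_vietoris_basic:
  assumes "Hausdorff_space X" "Hausdorff_space Y" "locally_compact_space X"
    and cont: "continuous_map X Y f" and op: "open_map X Y f"
    and U: "openin X (U 0)"
  shows "(\<lambda>A. f ` A) ` vietoris_basic X n U = vietoris_basic Y n (\<lambda>i. f ` (U 0 \<inter> U i))"
proof (intro equalityI subsetI)
  fix L assume "L \<in> (\<lambda>A. f ` A) ` vietoris_basic X n U"
  then obtain K where K: "compactin X K" "K \<noteq> {}" "K \<subseteq> U 0" "\<forall>i\<in>{1..n}. K \<inter> U i \<noteq> {}"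
    and L: "L = f ` K"
    by (auto simp: vietoris_basic_def compacts_of_def)
  have "f ` K \<inter> f ` (U 0 \<inter> U i) \<noteq> {}" if "i \<in> {1..n}" for i
    using K(3,4) that by blast
  moreover have "compactin Y (f ` K)"
    using K(1) cont image_compactin by blast
  ultimately show "L \<in> vietoris_basic Y n (\<lambda>i. f ` (U 0 \<inter> U i))"
    using K(2,3) unfolding L vietoris_basic_def compacts_of_def by auto
next
  fix L assume "L \<in> vietoris_basic Y n (\<lambda>i. f ` (U 0 \<inter> U i))"
  then have L: "compactin Y L" "L \<noteq> {}" "L \<subseteq> f ` U 0"
    and meets: "\<forall>i\<in>{1..n}. L \<inter> f ` (U 0 \<inter> U i) \<noteq> {}"
    by (auto simp: vietoris_basic_def compacts_of_def)
  obtain K where K: "compactin X K" "K \<subseteq> U 0" "f ` K = L"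
    using compact_lift[OF assms L(1,3)] by blast
  have "\<forall>i\<in>{1..n}. \<exists>x. x \<in> U 0 \<inter> U i \<and> f x \<in> L"
    using meets by blast
  then obtain x where x: "\<And>i. i \<in> {1..n} \<Longrightarrow> x i \<in> U 0 \<inter> U i \<and> f (x i) \<in> L"
    by metis
  define K' where "K' = K \<union> x ` {1..n}"
  have "compactin X (x ` {1..n})"
    using x openin_subset[OF U] by (intro finite_imp_compactin) auto
  then have "compactin X K'"
    unfolding K'_def using K(1) compactin_Un by blast
  moreover have "K' \<noteq> {}"
    using L(2) K(3) unfolding K'_def by blast
  moreover have "K' \<subseteq> U 0"
    using K(2) x unfolding K'_def by blast
  moreover have "\<forall>i\<in>{1..n}. K' \<inter> U i \<noteq> {}"
    using x unfolding K'_def by blast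
  ultimately have "K' \<in> vietoris_basic X n U"
    by (simp add: vietoris_basic_def compacts_of_def)
  moreover have "f ` K' = L"
    using K(3) x unfolding K'_def by blast
  ultimately show "L \<in> (\<lambda>A. f ` A) ` vietoris_basic X n U"
    by blast
qed

theorem proposition2p3:
  fixes X :: "'a topology" and Y :: "'b topology" and f :: "'a \<Rightarrow> 'b"
  assumes "Hausdorff_space X" and "Hausdorff_space Y"
    and "locally_compact_space X"
    and "continuous_map X Y f"
    and "f ` topspace X = topspace Y"
    and "open_map X Y f"
  shows "(\<lambda>A. f ` A) ` topspace (vietoris X) = topspace (vietoris Y)
       \<and> open_map (vietoris X) (vietoris Y) (\<lambda>A. f ` A)"
proof
  note hyps = assms(1-4,6)
  show "(\<lambda>A. f ` A) ` topspace (vietoris X) = topspace (vietoris Y)"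
  proof -
    \<comment> \<open>A basic set with only the containment condition, and that one vacuous, is the whole
      hyperspace.\<close>
    have whole: "compacts_of Z = vietoris_basic Z 0 (\<lambda>_. topspace Z)" for Z :: "'c topology"
      by (auto simp: vietoris_basic_def compacts_of_def dest: compactin_subset_topspace)
    show ?thesis
      using image_vietoris_basic[OF hyps, of "\<lambda>_. topspace X" 0] assms(5)
      by (simp add: topspace_vietoris whole)
  qed
  show "open_map (vietoris X) (vietoris Y) (\<lambda>A. f ` A)"
    unfolding open_map_def
  proof (intro allI impI)
    fix W assume W: "openin (vietoris X) W"
    show "openin (vietoris Y) ((\<lambda>A. f ` A) ` W)"
    proof (subst openin_subopen, intro ballI)
      fix L assume "L \<in> (\<lambda>A. f ` A) ` W"
      then obtain K where K: "K \<in> W" "L = f ` K"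
        by blast
      obtain n U where U: "\<forall>i\<le>n. openin X (U i)" "K \<in> vietoris_basic X n U"
          "vietoris_basic X n U \<subseteq> W"
        using openin_vietoris_imp_basic_nbhd[OF W K(1)] by blast
      have "\<forall>i\<le>n. openin Y (f ` (U 0 \<inter> U i))"
        using U(1) assms(6) by (simp add: open_map_def openin_Int)
      then have "openin (vietoris Y) ((\<lambda>A. f ` A) ` vietoris_basic X n U)"
        using image_vietoris_basic[OF hyps, of U n] U(1)
          openin_vietoris_basic[of n Y "\<lambda>i. f ` (U 0 \<inter> U i)"] by simp
      then show "\<exists>T. openin (vietoris Y) T \<and> L \<in> T \<and> T \<subseteq> (\<lambda>A. f ` A) ` W"
        using K(2) U(2,3) by (intro exI[of _ "(\<lambda>A. f ` A) ` vietoris_basic X n U"]) blast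
    qed
  qed
qed

end
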